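(* Let $d\ge1$, $L\ge2$, $1\le i,j,k,l\le d$, and let $z=z_1\dots z_m$, $w=w_1\dots w_n$ be two nonempty words in the alphabet $[L]$. The Poisson bracket of the generators $p_{ij}(z)$, $p_{kl}(w)$ of $\mathcal Y_{d,L}\subset P_{d,L}$ has the form $$\{p_{ij}(z),p_{kl}(w)\}=\sum_{r=1}^m\sum_{q=1}^n\delta_{z_r,w_q}\Bigl(p_{kj}(w_1\dots w_{q-1}z_{r+1}\dots z_m)\,p_{il}(z_1\dots z_{r-1}z_rw_{q+1}\dots w_n)-p_{kj}(w_1\dots w_{q-1}z_rz_{r+1}\dots z_m)\,p_{il}(z_1\dots z_{r-1}w_{q+1}\dots w_n)\Bigr),$$ with the convention that $p_{kj}(\varnothing)=\delta_{kj}$ and $p_{il}(\varnothing)=\delta_{il}$ for the empty word $\varnothing$.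
   Context: The ground field is $\mathbb C$. $E_{ij\mid\alpha}$ denotes the matrix unit $E_{ij}$ in the $\alpha$-th copy of $\mathfrak{gl}(N,\mathbb C)$ in $\mathfrak{gl}(N,\mathbb C)^{\oplus L}$, $\alpha\in[L]=\{1,\dots,L\}$; $S(\cdot)$ is the symmetric algebra. For $0\le d\le N$, $\mathfrak{gl}_d(N,\mathbb C)$ is the span of $E_{ij}$ with $d<i,j\le N$; $\operatorname{diag}$ is the diagonal embedding; $P_{d,L}(N):=S(\mathfrak{gl}(N,\mathbb C)^{\oplus L})^{\operatorname{diag}\mathfrak{gl}_d(N,\mathbb C)}$ (adjoint invariants). Let $\mathcal I^+(N)$ be the ideal of $S(\mathfrak{gl}(N,\mathbb C)^{\oplus L})$ generated by all $E_{iN\mid\alpha}$, $1\le i\le N$, $\alpha\in[L]$. Then $P_{N-1,L}(N)=S(\mathfrak{gl}(N-1,\mathbb C)^{\oplus L})\oplus(P_{N-1,L}(N)\cap\mathcal I^+(N))$; the projection $\pi_{N,N-1}$ onto the first summand maps $P_{d,L}(N)$ into $P_{d,L}(N-1)$ for $d\le N-1$. $P_{d,L}:=\varprojlim(P_{d,L}(N),\pi_{N,N-1})$ in the category of graded algebras. $P_{d,L}$ carries the Poisson bracket $\{-,-\}$ of degree $-1$ which comes, levelwise in $N$, from the canonical Poisson bracket of $S(\mathfrak{gl}(N,\mathbb C)^{\oplus L})$ (the one extending the Lie bracket of $\mathfrak{gl}(N,\mathbb C)^{\oplus L}$ by the Leibniz rule); the maps $\pi_{N,N-1}$ are Poisson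 on the algebras $P_{d,L}(N)$. Equivalently, it is induced by the commutator of the filtered algebra $A_{d,L}=\varprojlim U(\mathfrak{gl}(N,\mathbb C)^{\oplus L})^{\operatorname{diag}\mathfrak{gl}_d(N,\mathbb C)}$, for which $\operatorname{gr}A_{d,L}\simeq P_{d,L}$. For a nonempty word $w=w_1\dots w_n$ in the alphabet $[L]$ and $1\le i,j\le d$, $p_{ij}(w)\in P_{d,L}$ is the element defined by the sequence $$p_{ij}(w;N)=\sum_{a_1,\dots,a_{n-1}=1}^N E_{ia_1\mid w_1}E_{a_1a_2\mid w_2}\cdots E_{a_{n-1}j\mid w_n}\in P_{d,L}(N),$$ consistent with the $\pi_{N,N-1}$. $\mathcal Y_{d,L}\subset P_{d,L}$ is the unital subalgebra generated by all these $p_{ij}(w)$. *)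

theory Defs
  imports Complex_Main "HOL-Library.Poly_Mapping" "HOL-Library.Function_Algebras"
    "HOL-Library.FuncSet"
begin

section \<open>The symmetric algebras and their Poisson bracket\<close>

text \<open>
  The variable \<open>(i, j, \<alpha>)\<close> is the matrix unit \<open>E\<^bsub>ij|\<alpha>\<^esub>\<close>; matrix indices and copies are counted
  from 1. As the matrix units form a basis of \<open>gl(N)\<^sup>L\<close>, its symmetric algebra is the polynomial
  algebra in the \<open>E\<^bsub>ij|\<alpha>\<^esub>\<close> with \<open>1 \<le> i, j \<le> N\<close> and \<open>1 \<le> \<alpha> \<le> L\<close>. All these algebras are subalgebras
  of one polynomial ring, in the variables indexed by all triples of natural numbers.
\<close>

type_synonym unit_index = "nat \<times> nat \<times> nat"
type_synonym sym = "(unit_index \<Rightarrow>\<^sub>0 nat) \<Rightarrow>\<^sub>0 complex"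

definition const :: "complex \<Rightarrow> sym" where
  "const c = Poly_Mapping.single 0 c"

definition var :: "unit_index \<Rightarrow> sym" where
  "var x = Poly_Mapping.single (Poly_Mapping.single x 1) 1"

abbreviation mat_unit :: "nat \<Rightarrow> nat \<Rightarrow> nat \<Rightarrow> sym" where
  "mat_unit i j \<alpha> \<equiv> var (i, j, \<alpha>)"

definition sym_gl :: "nat \<Rightarrow> nat \<Rightarrow> sym set" where
  "sym_gl L N = {f. \<forall>m \<in> Poly_Mapping.keys f. Poly_Mapping.keys m \<subseteq> {1..N} \<times> {1..N} \<times> {1..L}}"

definition homogeneous :: "nat \<Rightarrow> sym \<Rightarrow> bool" where
  "homogeneous n f \<longleftrightarrow>
     (\<forall>m \<in> Poly_Mapping.keys f. (\<Sum>x \<in> Poly_Mapping.keys m. Poly_Mapping.lookup m x) = n)"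

fun lie_bracket :: "unit_index \<Rightarrow> unit_index \<Rightarrow> sym" where
  "lie_bracket (i, j, \<alpha>) (k, l, \<beta>) =
     (if \<alpha> = \<beta>
      then (if j = k then mat_unit i l \<alpha> else 0) - (if i = l then mat_unit k j \<alpha> else 0)
      else 0)"

definition extends_lie_bracket :: "(sym \<Rightarrow> sym \<Rightarrow> sym) \<Rightarrow> bool" where
  "extends_lie_bracket B \<longleftrightarrow>
     (\<forall>f g h. B (f + g) h = B f h + B g h) \<and>
     (\<forall>f g h. B h (f + g) = B h f + B h g) \<and>
     (\<forall>c f g. B (const c * f) g = const c * B f g) \<and>
     (\<forall>c f g. B f (const c * g) = const c * B f g) \<and>
     (\<forall>f g h. B (f * g) h = f * B g h + B f h * g) \<and>
     (\<forall>f g h. B h (f * g) = f * B h g + B h f * g) \<and>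
     (\<forall>x y. B (var x) (var y) = lie_bracket x y)"

text \<open>
  Exactly one such bracket exists, by \<open>ex1_extends_lie_bracket\<close> below. The structure constants do
  not depend on \<open>N\<close>, so it restricts to the canonical Poisson bracket on every \<open>sym_gl L N\<close>.
\<close>

definition poisson :: "sym \<Rightarrow> sym \<Rightarrow> sym" where
  "poisson = (THE B. extends_lie_bracket B)"


section \<open>Invariants and the projective limit\<close>

definition diag_embed :: "nat \<Rightarrow> nat \<Rightarrow> (nat \<Rightarrow> nat \<Rightarrow> complex) \<Rightarrow> sym" where
  "diag_embed L N X = (\<Sum>a = 1..N. \<Sum>b = 1..N. const (X a b) * (\<Sum>\<alpha> = 1..L. mat_unit a b \<alpha>))"

definition gl_sub :: "nat \<Rightarrow> nat \<Rightarrow> (nat \<Rightarrow> nat \<Rightarrow> complex) set" where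
  "gl_sub d N = {X. \<forall>a b. X a b \<noteq> 0 \<longrightarrow> a \<in> {d<..N} \<and> b \<in> {d<..N}}"

text \<open>The adjoint action of \<open>X\<close> on the symmetric algebra, the derivation extending \<open>[X, -]\<close>,
  is \<open>{X, -}\<close>.\<close>

definition P_level :: "nat \<Rightarrow> nat \<Rightarrow> nat \<Rightarrow> sym set" where
  "P_level d L N = {f \<in> sym_gl L N. \<forall>X \<in> gl_sub d N. poisson (diag_embed L N X) f = 0}"

definition I_plus :: "nat \<Rightarrow> nat \<Rightarrow> sym set" where
  "I_plus L N = {\<Sum>i = 1..N. \<Sum>\<alpha> = 1..L. h i \<alpha> * mat_unit i N \<alpha> | h. \<forall>i \<alpha>. h i \<alpha> \<in> sym_gl L N}"

text \<open>The projection of \<open>P_level (N - 1) L N\<close> onto the first summand of the decomposition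
  \<open>sym_gl L (N - 1) \<oplus> (P_level (N - 1) L N \<inter> I_plus L N)\<close>; it is only meaningful on that algebra.\<close>

definition proj :: "nat \<Rightarrow> nat \<Rightarrow> sym \<Rightarrow> sym" where
  "proj L N f = (THE g. g \<in> sym_gl L (N - 1) \<and> f - g \<in> P_level (N - 1) L N \<inter> I_plus L N)"

text \<open>
  Elements of the limit are sequences indexed by \<open>N\<close>, with the pointwise operations of
  \<open>Function_Algebras\<close>. Only the levels \<open>N \<ge> d\<close> exist, so the entries below \<open>d\<close> are set to \<open>0\<close>.
  In particular the unit of the limit is \<open>P_one d\<close> and not the constant sequence 1.
  The limit of graded algebras is the direct sum of the limits of the homogeneous components.
\<close>

definition P_comp :: "nat \<Rightarrow> nat \<Rightarrow> nat \<Rightarrow> (nat \<Rightarrow> sym) set" where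
  "P_comp d L n = {F. (\<forall>N < d. F N = 0) \<and>
     (\<forall>N \<ge> d. F N \<in> P_level d L N \<and> homogeneous n (F N) \<and> proj L (Suc N) (F (Suc N)) = F N)}"

definition P_lim :: "nat \<Rightarrow> nat \<Rightarrow> (nat \<Rightarrow> sym) set" where
  "P_lim d L = {\<Sum>n \<le> D. F n | D F. \<forall>n. F n \<in> P_comp d L n}"

definition P_one :: "nat \<Rightarrow> nat \<Rightarrow> sym" where
  "P_one d = (\<lambda>N. if d \<le> N then 1 else 0)"

text \<open>The bracket of the limit is computed levelwise; it is \<open>undefined\<close> outside \<open>P_lim d L\<close>.\<close>

definition P_bracket :: "nat \<Rightarrow> nat \<Rightarrow> (nat \<Rightarrow> sym) \<Rightarrow> (nat \<Rightarrow> sym) \<Rightarrow> (nat \<Rightarrow> sym)" where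
  "P_bracket d L = (\<lambda>F \<in> P_lim d L. \<lambda>G \<in> P_lim d L. \<lambda>N. poisson (F N) (G N))"


section \<open>The elements attached to words\<close>

text \<open>The list \<open>as\<close> holds the summation indices \<open>a\<^sub>1, \<dots>, a\<^bsub>n-1\<^esub>\<close>, and consecutive entries of
  \<open>i # as @ [j]\<close> are the row and column indices of the factors.\<close>

definition p_level :: "nat \<Rightarrow> nat \<Rightarrow> nat list \<Rightarrow> nat \<Rightarrow> sym" where
  "p_level i j w N =
     (\<Sum>as | set as \<subseteq> {1..N} \<and> length as = length w - 1.
        \<Prod>t < length w. mat_unit ((i # as @ [j]) ! t) ((i # as @ [j]) ! Suc t) (w ! t))"

definition p_seq :: "nat \<Rightarrow> nat \<Rightarrow> nat \<Rightarrow> nat list \<Rightarrow> (nat \<Rightarrow> sym)" where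
  "p_seq d i j w =
     (if w = [] then (if i = j then P_one d else 0)
      else (\<lambda>N. if d \<le> N then p_level i j w N else 0))"


section \<open>Existence and uniqueness of the Poisson bracket\<close>

lemma const_simps [simp]:
  "const 0 = 0" "const 1 = 1" "const (a + b) = const a + const b" "const (a * b) = const a * const b"
  by (simp_all add: const_def single_add mult_single)

lemma sym_induct [case_names const var add mult]:
  assumes "\<And>c. P (const c)" and "\<And>x. P (var x)"
    and "\<And>f g. P f \<Longrightarrow> P g \<Longrightarrow> P (f + g)" and "\<And>f g. P f \<Longrightarrow> P g \<Longrightarrow> P (f * g)"
  shows "P (f :: sym)"
proof -
  have pow: "P (Poly_Mapping.single (Poly_Mapping.single x k) 1)" for x k
  proof (induction k)
    case 0
    show ?case using assms(1)[of 1] by simp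
  next
    case (Suc k)
    have "Poly_Mapping.single (Poly_Mapping.single x (Suc k)) (1::complex)
        = var x * Poly_Mapping.single (Poly_Mapping.single x k) 1"
      by (simp add: var_def mult_single single_add[symmetric])
    then show ?case using assms(2,4) Suc by simp
  qed
  have upd: "Poly_Mapping.update a b f = Poly_Mapping.single a b + f"
    if "a \<notin> Poly_Mapping.keys f" for a f and b :: "'z::comm_monoid_add"
    using that by (intro poly_mapping_eqI)
      (auto simp: lookup_update lookup_add lookup_single in_keys_iff when_def)
  have mono: "P (Poly_Mapping.single m 1)" for m
  proof (induction m rule: update_induct)
    case const
    show ?case using assms(1)[of 1] by simp
  next
    case (update m x k)
    have "Poly_Mapping.single (Poly_Mapping.update x k m) (1::complex)
        = Poly_Mapping.single (Poly_Mapping.single x k) 1 * Poly_Mapping.single m 1"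
      using update by (simp add: upd mult_single)
    then show ?case using assms(4)[OF pow update(3)] by simp
  qed
  show ?thesis
  proof (induction f rule: update_induct)
    case const
    show ?case using assms(1)[of 0] by simp
  next
    case (update f m c)
    have "Poly_Mapping.single m c = const c * Poly_Mapping.single m 1"
      by (simp add: const_def mult_single)
    then have "P (Poly_Mapping.single m c)" using assms(1,4) mono by simp
    then show ?case using assms(3) update by (simp add: upd)
  qed
qed

definition mono_deriv :: "(unit_index \<Rightarrow> sym) \<Rightarrow> (unit_index \<Rightarrow>\<^sub>0 nat) \<Rightarrow> sym" where
  "mono_deriv \<delta> m = (\<Sum>x \<in> Poly_Mapping.keys m.
     Poly_Mapping.single (m - Poly_Mapping.single x 1) (of_nat (Poly_Mapping.lookup m x)) * \<delta> x)"

definition deriv_ext :: "(unit_index \<Rightarrow> sym) \<Rightarrow> sym \<Rightarrow> sym" where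
  "deriv_ext \<delta> f =
     (\<Sum>m \<in> Poly_Mapping.keys f. const (Poly_Mapping.lookup f m) * mono_deriv \<delta> m)"

lemma deriv_ext_add: "deriv_ext \<delta> (f + g) = deriv_ext \<delta> f + deriv_ext \<delta> g"
  unfolding deriv_ext_def
  by (rule setsum_keys_plus_distrib) (simp_all add: algebra_simps)

lemma deriv_ext_single: "deriv_ext \<delta> (Poly_Mapping.single m c) = const c * mono_deriv \<delta> m"
  by (cases "c = 0") (simp_all add: deriv_ext_def)

lemma mono_deriv_superset:
  assumes "finite A" "Poly_Mapping.keys m \<subseteq> A"
  shows "mono_deriv \<delta> m = (\<Sum>x \<in> A.
     Poly_Mapping.single (m - Poly_Mapping.single x 1) (of_nat (Poly_Mapping.lookup m x)) * \<delta> x)"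
  unfolding mono_deriv_def
  by (rule sum.mono_neutral_left) (use assms in \<open>auto simp: in_keys_iff\<close>)

lemma mono_deriv_add:
  "mono_deriv \<delta> (m + n) =
     Poly_Mapping.single m 1 * mono_deriv \<delta> n + mono_deriv \<delta> m * Poly_Mapping.single n 1"
proof -
  let ?A = "Poly_Mapping.keys m \<union> Poly_Mapping.keys n"
  let ?s = "\<lambda>x. Poly_Mapping.single x (1::nat)"
  have shift: "Poly_Mapping.single (a + b - ?s x) (of_nat (Poly_Mapping.lookup b x) :: complex)
      = Poly_Mapping.single (a + (b - ?s x)) (of_nat (Poly_Mapping.lookup b x))"
    for a b :: "unit_index \<Rightarrow>\<^sub>0 nat" and x
  proof (cases "Poly_Mapping.lookup b x = 0")
    case False
    have "a + b - ?s x = a + (b - ?s x)"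
      using False by (intro poly_mapping_eqI)
        (auto simp: lookup_add lookup_minus lookup_single when_def)
    then show ?thesis by simp
  qed simp
  have "mono_deriv \<delta> (m + n) = (\<Sum>x \<in> ?A. Poly_Mapping.single (m + n - ?s x)
          (of_nat (Poly_Mapping.lookup m x) + of_nat (Poly_Mapping.lookup n x)) * \<delta> x)"
    by (subst mono_deriv_superset[of ?A]) (use keys_add[of m n] in \<open>auto simp: lookup_add\<close>)
  also have "\<dots> = (\<Sum>x \<in> ?A.
      Poly_Mapping.single (n + (m - ?s x)) (of_nat (Poly_Mapping.lookup m x)) * \<delta> x
      + Poly_Mapping.single (m + (n - ?s x)) (of_nat (Poly_Mapping.lookup n x)) * \<delta> x)"
    using shift[of m n] shift[of n m] by (simp add: single_add distrib_right add.commute[of m n])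
  also have "\<dots> = Poly_Mapping.single m 1 * mono_deriv \<delta> n
      + mono_deriv \<delta> m * Poly_Mapping.single n 1"
    by (subst (1 2) mono_deriv_superset[of ?A])
      (simp_all add: sum.distrib sum_distrib_left sum_distrib_right mult_single
        mult.assoc[symmetric] add.commute mult.commute[of _ "Poly_Mapping.single n 1"])
  finally show ?thesis .
qed

lemma sym_add_induct [case_names zero single add]:
  assumes "P 0" "\<And>m c. P (Poly_Mapping.single m c)" "\<And>f g. P f \<Longrightarrow> P g \<Longrightarrow> P (f + g)"
  shows "P (f :: sym)"
proof (induction f rule: update_induct)
  case (update f a b)
  have "Poly_Mapping.update a b f = Poly_Mapping.single a b + f"
    using update(1) by (intro poly_mapping_eqI)
      (auto simp: lookup_update lookup_add lookup_single in_keys_iff when_def)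
  then show ?case using assms update by simp
qed (rule assms)

lemma deriv_ext_mult: "deriv_ext \<delta> (f * g) = f * deriv_ext \<delta> g + deriv_ext \<delta> f * g"
proof (induction f rule: sym_add_induct)
  case zero
  show ?case by (simp add: deriv_ext_def)
next
  case (add f1 f2)
  then show ?case by (simp add: algebra_simps deriv_ext_add)
next
  case (single m c)
  show ?case
  proof (induction g rule: sym_add_induct)
    case zero
    show ?case by (simp add: deriv_ext_def)
  next
    case (add f1 f2)
    then show ?case by (simp add: algebra_simps deriv_ext_add)
  next
    case (single n c')
    have s: "Poly_Mapping.single k b = const b * Poly_Mapping.single k 1" for k b
      by (simp add: const_def mult_single)
    have "deriv_ext \<delta> (Poly_Mapping.single m c * Poly_Mapping.single n c') =
        const c * const c' * (Poly_Mapping.single m 1 * mono_deriv \<delta> n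
          + mono_deriv \<delta> m * Poly_Mapping.single n 1)"
      by (simp add: mult_single deriv_ext_single mono_deriv_add)
    also have "\<dots> = (const c * Poly_Mapping.single m 1) * (const c' * mono_deriv \<delta> n)
        + (const c * mono_deriv \<delta> m) * (const c' * Poly_Mapping.single n 1)"
      by (simp only: algebra_simps)
    finally show ?case by (simp only: deriv_ext_single s[of m c, symmetric] s[of n c', symmetric])
  qed
qed

lemma deriv_ext_const [simp]: "deriv_ext \<delta> (const c) = 0"
  unfolding const_def deriv_ext_single by (simp add: mono_deriv_def)

lemma deriv_ext_var [simp]: "deriv_ext \<delta> (var x) = \<delta> x"
  unfolding var_def deriv_ext_single by (simp add: mono_deriv_def)

lemma deriv_ext_fun_linear:
  "deriv_ext (\<lambda>x. \<delta> x + \<epsilon> x) f = deriv_ext \<delta> f + deriv_ext \<epsilon> f"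
  "deriv_ext (\<lambda>x. h * \<delta> x) f = h * deriv_ext \<delta> f"
  "deriv_ext (\<lambda>x. \<delta> x * h) f = deriv_ext \<delta> f * h"
  by (simp_all add: deriv_ext_def mono_deriv_def sum.distrib sum_distrib_left sum_distrib_right
      distrib_left distrib_right ac_simps)

lemma extends_lie_bracket_deriv_ext:
  "extends_lie_bracket (\<lambda>f g. deriv_ext (\<lambda>x. deriv_ext (lie_bracket x) g) f)"
  unfolding extends_lie_bracket_def
  by (intro conjI allI)
    (simp_all add: deriv_ext_add deriv_ext_mult deriv_ext_fun_linear)

lemma extends_lie_bracket_unique:
  assumes B: "extends_lie_bracket B" and C: "extends_lie_bracket C"
  shows "B = C"
proof -
  have left0: "X (const c) g = 0" and right0: "X g (const c) = 0"
    if X: "extends_lie_bracket X" for X c g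
  proof -
    have "X (1 * 1) g = 1 * X 1 g + X 1 g * 1" "X g (1 * 1) = 1 * X g 1 + X g 1 * 1"
      using X unfolding extends_lie_bracket_def by blast+
    then have "X 1 g = 0" "X g 1 = 0" by simp_all
    moreover have "X (const c * 1) g = const c * X 1 g" "X g (const c * 1) = const c * X g 1"
      using X unfolding extends_lie_bracket_def by blast+
    ultimately show "X (const c) g = 0" "X g (const c) = 0" by simp_all
  qed
  have add: "X (f + g) h = X f h + X g h" "X h (f + g) = X h f + X h g"
    and mult: "X (f * g) h = f * X g h + X f h * g" "X h (f * g) = f * X h g + X h f * g"
    and lie: "X (var x) (var y) = lie_bracket x y"
    if "extends_lie_bracket X" for X f g h x y
    using that unfolding extends_lie_bracket_def by blast+
  have var: "B (var x) g = C (var x) g" for x g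
    by (induction g rule: sym_induct)
      (simp_all only: right0[OF B] right0[OF C] lie[OF B] lie[OF C] add[OF B] add[OF C]
        mult[OF B] mult[OF C])
  have "B f g = C f g" for f g
    by (induction f rule: sym_induct)
      (simp_all only: left0[OF B] left0[OF C] var add[OF B] add[OF C] mult[OF B] mult[OF C])
  then show ?thesis by (intro ext)
qed

lemma ex1_extends_lie_bracket: "\<exists>!B. extends_lie_bracket B"
  using extends_lie_bracket_deriv_ext extends_lie_bracket_unique by blast

lemma extends_lie_bracket_poisson: "extends_lie_bracket poisson"
  unfolding poisson_def by (rule theI'[OF ex1_extends_lie_bracket])

end

theory Submission
  imports Defs
begin

text \<open>
  For each copy \<open>\<alpha>\<close> collect the matrix units into the generic matrix \<open>E\<^sub>\<alpha> = (E\<^bsub>ab|\<alpha>\<^esub>)\<close>. At level \<open>N\<close>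
  the element attached to a word \<open>w\<close> is the \<open>(i, j)\<close> entry of the matrix product
  \<open>E\<^bsub>w1\<^esub> \<cdots> E\<^bsub>wn\<^esub>\<close>, and the empty word gives the identity matrix, which is exactly the
  convention for empty words (\<open>p_level_eq_word_entry\<close>). Concatenation of words becomes the product
  of matrices (\<open>word_entry_append\<close>), so every step below is matrix calculus.

  The bracket is a derivation in each argument. Expanding both products by the Leibniz rule picks
  a letter \<open>z\<^sub>r\<close> and a letter \<open>w\<^sub>q\<close>, and leaves the sum over all \<open>a, b, c, e\<close> of
  \<open>E(z\<^bsub><r\<^esub>)\<^bsub>ia\<^esub> E(z\<^bsub>>r\<^esub>)\<^bsub>bj\<^esub> E(w\<^bsub><q\<^esub>)\<^bsub>kc\<^esub> E(w\<^bsub>>q\<^esub>)\<^bsub>el\<^esub> {E\<^bsub>ab|zr\<^esub>, E\<^bsub>ce|wq\<^esub>}\<close>,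
  where \<open>E(u)\<close> is the product of the generic matrices along \<open>u\<close>.
  The bracket vanishes unless the two letters agree, in which case it is
  \<open>\<delta>\<^bsub>bc\<^esub> E\<^bsub>ae\<^esub> - \<delta>\<^bsub>ae\<^esub> E\<^bsub>cb\<^esub>\<close>. The first delta contracts the four matrices to two products, one
  from \<open>k\<close> to \<open>j\<close> and one from \<open>i\<close> to \<open>l\<close> that contains the common letter; the second delta does the
  same with the common letter in the product from \<open>k\<close> to \<open>j\<close>. This is the formula, level by level
  (\<open>poisson_word_entry\<close>).

  The bracket on the limit is the levelwise one only on \<open>P_lim\<close>, so the sequences have to be
  placed there (\<open>p_seq_in_P_comp\<close>). Invariance: the diagonal action of a matrix \<open>X\<close> on a matrix
  product telescopes to the terms at the two ends, and these vanish because the outer indices are at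
  most \<open>d\<close> (\<open>poisson_diag_embed_word_entry\<close>). Compatibility with the projections: a summand
  of level \<open>N + 1\<close> in which the index \<open>N + 1\<close> occurs contains a factor from the last column, hence
  lies in the ideal (\<open>word_entry_Suc_diff_in_I_plus\<close>), and this determines the projection because
  the ideal meets the algebra of level \<open>N\<close> only in \<open>0\<close> (\<open>proj_eqI\<close>).
\<close>


section \<open>Words as products of generic matrices\<close>

text \<open>The entries of the product of the generic matrices along a word. The recursion, in place of a
  sum over index lists, makes the Leibniz rule and concatenation plain inductions.\<close>

fun word_entry :: "nat \<Rightarrow> nat list \<Rightarrow> nat \<Rightarrow> nat \<Rightarrow> sym" where
  "word_entry N [] i j = (if i = j then 1 else 0)"
| "word_entry N (\<alpha> # w) i j = (\<Sum>b = 1..N. mat_unit i b \<alpha> * word_entry N w b j)"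

text \<open>The first of the summation indices \<open>a\<^sub>1, \<dots>, a\<^bsub>n-1\<^esub>\<close> is split off; it exists because the word
  has at least two letters.\<close>

lemma p_level_Cons_Cons:
  "p_level i j (\<alpha> # \<beta> # w) N = (\<Sum>b = 1..N. mat_unit i b \<alpha> * p_level b j (\<beta> # w) N)"
proof -
  let ?A = "\<lambda>n. {as. set as \<subseteq> {1..N} \<and> length as = n}"
  let ?f = "\<lambda>i w as. \<Prod>t < length w.
    mat_unit ((i # as @ [j]) ! t) ((i # as @ [j]) ! Suc t) (w ! t)"
  have inj: "inj_on (\<lambda>(b, as). b # as) ({1..N} \<times> ?A (length w))"
    by (auto simp: inj_on_def)
  have img: "?A (Suc (length w)) = (\<lambda>(b, as). b # as) ` ({1..N} \<times> ?A (length w))"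
  proof (rule set_eqI)
    fix as
    show "as \<in> ?A (Suc (length w)) \<longleftrightarrow> as \<in> (\<lambda>(b, as). b # as) ` ({1..N} \<times> ?A (length w))"
      by (cases as) auto
  qed
  have "p_level i j (\<alpha> # \<beta> # w) N = sum (?f i (\<alpha> # \<beta> # w)) (?A (Suc (length w)))"
    by (simp add: p_level_def)
  also have "\<dots> = (\<Sum>(b, as) \<in> {1..N} \<times> ?A (length w). ?f i (\<alpha> # \<beta> # w) (b # as))"
    unfolding img by (subst sum.reindex[OF inj]) (simp add: case_prod_unfold)
  also have "\<dots> = (\<Sum>(b, as) \<in> {1..N} \<times> ?A (length w). mat_unit i b \<alpha> * ?f b (\<beta> # w) as)"
  proof (rule sum.cong[OF refl], clarify)
    fix b as
    show "?f i (\<alpha> # \<beta> # w) (b # as) = mat_unit i b \<alpha> * ?f b (\<beta> # w) as"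
      by (simp only: length_Cons prod.lessThan_Suc_shift) simp
  qed
  also have "\<dots> = (\<Sum>b = 1..N. mat_unit i b \<alpha> * p_level b j (\<beta> # w) N)"
    by (simp add: sum.cartesian_product[symmetric] sum_distrib_left p_level_def)
  finally show ?thesis .
qed

text \<open>The bound on \<open>j\<close> matters only for the last letter: the recursion ends in a sum against the
  identity matrix of size \<open>N\<close>, which must have a column \<open>j\<close>. Likewise below, a bound on an outer
  index lets the identity matrix act on it.\<close>

lemma p_level_eq_word_entry:
  assumes "w \<noteq> []" "j \<in> {1..N}"
  shows "p_level i j w N = word_entry N w i j"
  using assms(1)
proof (induction w arbitrary: i rule: list_nonempty_induct)
  case (single \<alpha>)
  have "{as::nat list. set as \<subseteq> {1..N} \<and> as = []} = {[]}"
    by auto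
  with assms(2) show ?case
    by (simp add: p_level_def if_distrib[of "(*) _"] cong: if_cong)
next
  case (cons \<alpha> w)
  then obtain \<beta> v where w: "w = \<beta> # v"
    by (cases w) auto
  show ?case
    unfolding w p_level_Cons_Cons using cons.IH by (simp add: w)
qed

lemma word_entry_append:
  assumes "i \<in> {1..N}"
  shows "word_entry N (u @ v) i j = (\<Sum>b = 1..N. word_entry N u i b * word_entry N v b j)"
  using assms
proof (induction u arbitrary: i)
  case Nil
  then show ?case
    by (simp add: if_distrib[of "\<lambda>x. x * _"] cong: if_cong)
next
  case (Cons \<alpha> u)
  have "word_entry N ((\<alpha> # u) @ v) i j
      = (\<Sum>a = 1..N. \<Sum>b = 1..N. mat_unit i a \<alpha> * word_entry N u a b * word_entry N v b j)"
    using Cons.IH by (simp add: sum_distrib_left mult.assoc)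
  also have "\<dots> = (\<Sum>b = 1..N. word_entry N (\<alpha> # u) i b * word_entry N v b j)"
    by (subst sum.swap) (simp add: sum_distrib_right)
  finally show ?case .
qed

lemma word_entry_singleton:
  assumes "j \<in> {1..N}"
  shows "word_entry N [\<alpha>] i j = mat_unit i j \<alpha>"
  using assms by (simp add: if_distrib[of "(*) _"] cong: if_cong)


section \<open>The bracket of two entries\<close>

text \<open>Both the bracket with a fixed left argument and the one with a fixed right argument are
  derivations, so one Leibniz expansion of a matrix product serves for both.\<close>

locale derivation =
  fixes D :: "sym \<Rightarrow> sym"
  assumes add: "D (f + g) = D f + D g"
    and mult: "D (f * g) = f * D g + D f * g"
begin

lemma zero [simp]: "D 0 = 0"
  using add[of 0 0] by simp

lemma one [simp]: "D 1 = 0"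
  using mult[of 1 1] by simp

lemma diff: "D (f - g) = D f - D g"
  using add[of "f - g" g] by simp

lemma sum: "D (sum f A) = (\<Sum>x \<in> A. D (f x))"
  by (induction A rule: infinite_finite_induct) (simp_all add: add)

text \<open>The Leibniz rule along a product of matrices: each letter in turn is differentiated, between
  the product of the letters before it and that of the letters after it.\<close>

lemma word_entry:
  assumes "i \<in> {1..N}"
  shows "D (word_entry N w i j) = (\<Sum>t < length w. \<Sum>a = 1..N. \<Sum>b = 1..N.
    word_entry N (take t w) i a * D (mat_unit a b (w ! t)) * word_entry N (drop (Suc t) w) b j)"
  using assms
proof (induction w arbitrary: i)
  case Nil
  then show ?case by simp
next
  case (Cons \<alpha> w)
  let ?T = "\<lambda>w i t a b.
    word_entry N (take t w) i a * D (mat_unit a b (w ! t)) * word_entry N (drop (Suc t) w) b j"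
  \<comment> \<open>The prefix before the first letter is empty, hence the identity matrix.\<close>
  have first: "(\<Sum>a = 1..N. \<Sum>b = 1..N. ?T (\<alpha> # w) i 0 a b)
      = (\<Sum>b = 1..N. D (mat_unit i b \<alpha>) * word_entry N w b j)"
    using Cons.prems
    by (subst sum.swap) (simp add: if_distrib[of "\<lambda>x. x * _"] cong: if_cong)
  have later: "(\<Sum>a = 1..N. \<Sum>b = 1..N. ?T (\<alpha> # w) i (Suc t) a b)
      = (\<Sum>c = 1..N. mat_unit i c \<alpha> * (\<Sum>a = 1..N. \<Sum>b = 1..N. ?T w c t a b))" for t
  proof -
    have "(\<Sum>a = 1..N. \<Sum>b = 1..N. ?T (\<alpha> # w) i (Suc t) a b)
        = (\<Sum>a = 1..N. \<Sum>b = 1..N. \<Sum>c = 1..N. mat_unit i c \<alpha> * ?T w c t a b)"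
      by (simp add: sum_distrib_right mult.assoc)
    also have "\<dots> = (\<Sum>a = 1..N. \<Sum>c = 1..N. \<Sum>b = 1..N. mat_unit i c \<alpha> * ?T w c t a b)"
      by (intro sum.cong refl sum.swap)
    also have "\<dots> = (\<Sum>c = 1..N. \<Sum>a = 1..N. \<Sum>b = 1..N. mat_unit i c \<alpha> * ?T w c t a b)"
      by (rule sum.swap)
    finally show ?thesis
      by (simp add: sum_distrib_left)
  qed
  have "D (word_entry N (\<alpha> # w) i j)
      = (\<Sum>c = 1..N. mat_unit i c \<alpha> * D (word_entry N w c j))
        + (\<Sum>c = 1..N. D (mat_unit i c \<alpha>) * word_entry N w c j)"
    by (simp add: sum mult sum.distrib)
  also have "(\<Sum>c = 1..N. mat_unit i c \<alpha> * D (word_entry N w c j))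
      = (\<Sum>c = 1..N. \<Sum>t < length w. mat_unit i c \<alpha> * (\<Sum>a = 1..N. \<Sum>b = 1..N. ?T w c t a b))"
    using Cons.IH by (intro sum.cong refl) (simp add: sum_distrib_left)
  also have "\<dots> = (\<Sum>t < length w. \<Sum>a = 1..N. \<Sum>b = 1..N. ?T (\<alpha> # w) i (Suc t) a b)"
    unfolding later by (rule sum.swap)
  finally show ?case
    unfolding length_Cons sum.lessThan_Suc_shift first by (simp only: add.commute)
qed

end

lemma poisson_rules:
  "poisson (f + g) h = poisson f h + poisson g h"
  "poisson h (f + g) = poisson h f + poisson h g"
  "poisson (const c * f) g = const c * poisson f g"
  "poisson (f * g) h = f * poisson g h + poisson f h * g"
  "poisson h (f * g) = f * poisson h g + poisson h f * g"
  "poisson (var x) (var y) = lie_bracket x y"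
  using extends_lie_bracket_poisson unfolding extends_lie_bracket_def by blast+

interpretation poisson_right: derivation "poisson f" for f
  by unfold_locales (rule poisson_rules)+

interpretation poisson_left: derivation "\<lambda>f. poisson f g" for g
  by unfold_locales (rule poisson_rules)+

text \<open>The inner half of the computation. The structure constants of the matrix units cut \<open>w\<close> open at
  an occurrence of \<open>\<alpha>\<close>; of the two open ends, the one at \<open>k\<close> receives the index \<open>b\<close> and the one at
  \<open>l\<close> receives \<open>a\<close>. The letter \<open>\<alpha>\<close> itself ends up in either piece, once for each sign.\<close>

lemma poisson_mat_unit_word_entry:
  assumes "a \<in> {1..N}" "b \<in> {1..N}" "k \<in> {1..N}"
  shows "poisson (mat_unit a b \<alpha>) (word_entry N w k l) =
    (\<Sum>q < length w. if \<alpha> = w ! q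
      then word_entry N (take q w) k b * word_entry N (\<alpha> # drop (Suc q) w) a l
         - word_entry N (take q w @ [\<alpha>]) k b * word_entry N (drop (Suc q) w) a l
      else 0)"
  unfolding poisson_right.word_entry[OF assms(3)]
proof (rule sum.cong[OF refl])
  fix q
  let ?p = "\<lambda>c. word_entry N (take q w) k c" and ?s = "\<lambda>e. word_entry N (drop (Suc q) w) e l"
  let ?L = "\<Sum>c = 1..N. \<Sum>e = 1..N. ?p c * poisson (mat_unit a b \<alpha>) (mat_unit c e (w ! q)) * ?s e"
  have "?L = (\<Sum>c = 1..N. \<Sum>e = 1..N. (if b = c then ?p c * mat_unit a e \<alpha> * ?s e else 0)
      - (if a = e then ?p c * mat_unit c b \<alpha> * ?s e else 0))" if "\<alpha> = w ! q"
    using that by (intro sum.cong refl) (auto simp: poisson_rules algebra_simps)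
  also have "\<dots> = (\<Sum>e = 1..N. ?p b * mat_unit a e \<alpha> * ?s e)
      - (\<Sum>c = 1..N. ?p c * mat_unit c b \<alpha> * ?s a)"
  proof -
    have "(\<Sum>c = 1..N. \<Sum>e = 1..N. if b = c then ?p c * mat_unit a e \<alpha> * ?s e else 0)
        = (\<Sum>e = 1..N. ?p b * mat_unit a e \<alpha> * ?s e)"
      using assms(2) by (subst sum.swap) simp
    moreover have "(\<Sum>c = 1..N. \<Sum>e = 1..N. if a = e then ?p c * mat_unit c b \<alpha> * ?s e else 0)
        = (\<Sum>c = 1..N. ?p c * mat_unit c b \<alpha> * ?s a)"
      using assms(1) by simp
    ultimately show ?thesis
      by (simp add: sum_subtractf)
  qed
  also have "\<dots> = ?p b * word_entry N (\<alpha> # drop (Suc q) w) a l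
      - word_entry N (take q w @ [\<alpha>]) k b * ?s a"
    unfolding word_entry_append[OF assms(3)] word_entry_singleton[OF assms(2)]
    by (simp add: sum_distrib_left sum_distrib_right mult.assoc)
  finally have same: "\<alpha> = w ! q \<Longrightarrow> ?L = ?p b * word_entry N (\<alpha> # drop (Suc q) w) a l
      - word_entry N (take q w @ [\<alpha>]) k b * ?s a" .
  show "?L = (if \<alpha> = w ! q
      then ?p b * word_entry N (\<alpha> # drop (Suc q) w) a l
         - word_entry N (take q w @ [\<alpha>]) k b * ?s a
      else 0)"
  proof (cases "\<alpha> = w ! q")
    case True
    from same[OF this] show ?thesis
      by (simp only: if_P[OF True])
  next
    case False
    then show ?thesis
      by (simp add: poisson_rules)
  qed
qed

text \<open>The level form of the theorem. Summing over the open indices \<open>a\<close> and \<open>b\<close> splices the two pieces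
  of \<open>w\<close> to the two pieces of \<open>z\<close> crosswise.\<close>

lemma poisson_word_entry:
  assumes "i \<in> {1..N}" "k \<in> {1..N}"
  shows "poisson (word_entry N z i j) (word_entry N w k l) =
    (\<Sum>r < length z. \<Sum>q < length w. if z ! r = w ! q
      then word_entry N (take q w @ drop (Suc r) z) k j * word_entry N (take (Suc r) z @ drop (Suc q) w) i l
         - word_entry N (take q w @ drop r z) k j * word_entry N (take r z @ drop (Suc q) w) i l
      else 0)"
  unfolding poisson_left.word_entry[OF assms(1)]
proof (rule sum.cong[OF refl])
  fix r
  assume r: "r \<in> {..<length z}"
  let ?e = "word_entry N" and ?\<alpha> = "z ! r"
  let ?P = "take r z" and ?S = "drop (Suc r) z"
  let ?p = "\<lambda>q. take q w" and ?s = "\<lambda>q. drop (Suc q) w"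
  \<comment> \<open>The sum over \<open>b\<close> joins a prefix of \<open>w\<close> to the end of \<open>z\<close>, the sum over \<open>a\<close> joins the start of
    \<open>z\<close> to a suffix of \<open>w\<close>.\<close>
  have glue: "(\<Sum>a = 1..N. \<Sum>b = 1..N. ?e ?P i a * (?e u k b * ?e v a l) * ?e ?S b j)
      = ?e (u @ ?S) k j * ?e (?P @ v) i l" for u v
    unfolding word_entry_append[OF assms(1)] word_entry_append[OF assms(2)] sum_product
    by (subst sum.swap) (simp add: mult_ac)
  have "(\<Sum>a = 1..N. \<Sum>b = 1..N. ?e ?P i a * poisson (mat_unit a b ?\<alpha>) (?e w k l) * ?e ?S b j)
      = (\<Sum>a = 1..N. \<Sum>b = 1..N. \<Sum>q < length w. if ?\<alpha> = w ! q
          then ?e ?P i a * (?e (?p q) k b * ?e (?\<alpha> # ?s q) a l) * ?e ?S b j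
             - ?e ?P i a * (?e (?p q @ [?\<alpha>]) k b * ?e (?s q) a l) * ?e ?S b j
          else 0)"
    unfolding sum_distrib_left[symmetric] sum_distrib_right[symmetric]
  proof (intro sum.cong refl)
    fix a b
    assume ab: "a \<in> {1..N}" "b \<in> {1..N}"
    show "?e ?P i a * poisson (mat_unit a b ?\<alpha>) (?e w k l) * ?e ?S b j = (\<Sum>q < length w.
        if ?\<alpha> = w ! q
          then ?e ?P i a * (?e (?p q) k b * ?e (?\<alpha> # ?s q) a l) * ?e ?S b j
             - ?e ?P i a * (?e (?p q @ [?\<alpha>]) k b * ?e (?s q) a l) * ?e ?S b j
          else 0)"
      unfolding poisson_mat_unit_word_entry[OF ab assms(2)] sum_distrib_left sum_distrib_right
      by (intro sum.cong refl) (simp add: algebra_simps del: word_entry.simps)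
  qed
  also have "\<dots> = (\<Sum>q < length w. \<Sum>a = 1..N. \<Sum>b = 1..N. if ?\<alpha> = w ! q
          then ?e ?P i a * (?e (?p q) k b * ?e (?\<alpha> # ?s q) a l) * ?e ?S b j
             - ?e ?P i a * (?e (?p q @ [?\<alpha>]) k b * ?e (?s q) a l) * ?e ?S b j
          else 0)"
    by (subst sum.swap[of _ "{..<length w}"], subst sum.swap[of _ "{..<length w}"]) (rule refl)
  also have "\<dots> = (\<Sum>q < length w. if ?\<alpha> = w ! q
          then ?e (?p q @ ?S) k j * ?e (?P @ ?\<alpha> # ?s q) i l
             - ?e ((?p q @ [?\<alpha>]) @ ?S) k j * ?e (?P @ ?s q) i l
          else 0)"
    by (intro sum.cong refl)
      (auto simp only: sum_subtractf glue sum.neutral_const simp_thms if_True if_False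
        split: if_split)
  finally show "(\<Sum>a = 1..N. \<Sum>b = 1..N.
        ?e ?P i a * poisson (mat_unit a b ?\<alpha>) (?e w k l) * ?e ?S b j)
      = (\<Sum>q < length w. if ?\<alpha> = w ! q
          then ?e (?p q @ ?S) k j * ?e (take (Suc r) z @ ?s q) i l
             - ?e (?p q @ drop r z) k j * ?e (?P @ ?s q) i l
          else 0)"
    using r by (simp only: take_Suc_conv_app_nth Cons_nth_drop_Suc[symmetric] lessThan_iff
      append_assoc append_Cons append_Nil)
qed


section \<open>Invariance\<close>

text \<open>This is the commutator of \<open>X\<close> with a matrix unit. The row and the column of the matrix unit
  are allowed to exceed \<open>N\<close>, where the corresponding term is absent.\<close>

lemma poisson_diag_embed_mat_unit:
  assumes "\<alpha> \<in> {1..L}"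
  shows "poisson (diag_embed L N X) (mat_unit c e \<alpha>) =
    (if c \<in> {1..N} then \<Sum>a = 1..N. const (X a c) * mat_unit a e \<alpha> else 0)
    - (if e \<in> {1..N} then \<Sum>b = 1..N. const (X e b) * mat_unit c b \<alpha> else 0)"
proof -
  have units: "(\<Sum>\<beta> = 1..L. poisson (mat_unit a b \<beta>) (mat_unit c e \<alpha>))
      = (if b = c then mat_unit a e \<alpha> else 0) - (if a = e then mat_unit c b \<alpha> else 0)" for a b
    using assms by (simp add: poisson_rules)
  have "poisson (diag_embed L N X) (mat_unit c e \<alpha>)
      = (\<Sum>a = 1..N. \<Sum>b = 1..N. if b = c then const (X a b) * mat_unit a e \<alpha> else 0)
        - (\<Sum>a = 1..N. \<Sum>b = 1..N. if a = e then const (X a b) * mat_unit c b \<alpha> else 0)"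
    unfolding diag_embed_def poisson_left.sum poisson_rules(3) sum_subtractf[symmetric] units
    by (intro sum.cong refl) (simp add: algebra_simps)
  also have "(\<Sum>a = 1..N. \<Sum>b = 1..N. if b = c then const (X a b) * mat_unit a e \<alpha> else 0)
      = (if c \<in> {1..N} then \<Sum>a = 1..N. const (X a c) * mat_unit a e \<alpha> else 0)"
    by (cases "c \<in> {1..N}") auto
  also have "(\<Sum>a = 1..N. \<Sum>b = 1..N. if a = e then const (X a b) * mat_unit c b \<alpha> else 0)
      = (if e \<in> {1..N} then \<Sum>b = 1..N. const (X e b) * mat_unit c b \<alpha> else 0)"
    by (subst sum.swap, cases "e \<in> {1..N}") auto
  finally show ?thesis .
qed

text \<open>The action is by commutators on each factor of the matrix product, so the contributions between
  neighbouring factors cancel and only the two outer ends remain.\<close>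

lemma poisson_diag_embed_word_entry:
  assumes "set w \<subseteq> {1..L}" "i \<in> {1..N}" "j \<in> {1..N}"
  shows "poisson (diag_embed L N X) (word_entry N w i j) =
    (\<Sum>a = 1..N. const (X a i) * word_entry N w a j)
    - (\<Sum>b = 1..N. const (X j b) * word_entry N w i b)"
  using assms(1,2)
proof (induction w arbitrary: i)
  case Nil
  with assms(3) show ?case
    by (simp add: if_distrib[of "(*) _"] cong: if_cong)
next
  case (Cons \<alpha> w)
  let ?e = "word_entry N w" and ?E = "\<lambda>a b. mat_unit a b \<alpha>" and ?X = "\<lambda>a b. const (X a b)"
  have "poisson (diag_embed L N X) (word_entry N (\<alpha> # w) i j)
      = (\<Sum>c = 1..N. ?E i c * ((\<Sum>a = 1..N. ?X a c * ?e a j) - (\<Sum>b = 1..N. ?X j b * ?e c b))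
          + ((\<Sum>a = 1..N. ?X a i * ?E a c) - (\<Sum>b = 1..N. ?X c b * ?E i b)) * ?e c j)"
    using Cons by (simp add: poisson_right.sum poisson_rules poisson_diag_embed_mat_unit)
  also have "\<dots> = (\<Sum>c = 1..N. \<Sum>a = 1..N. ?E i c * ?X a c * ?e a j)
        - (\<Sum>c = 1..N. \<Sum>b = 1..N. ?X c b * ?E i b * ?e c j)
      + ((\<Sum>c = 1..N. \<Sum>a = 1..N. ?X a i * ?E a c * ?e c j)
        - (\<Sum>c = 1..N. \<Sum>b = 1..N. ?E i c * ?X j b * ?e c b))"
    by (simp add: sum.distrib sum_subtractf sum_distrib_left sum_distrib_right
        ring_distribs mult.assoc)
  \<comment> \<open>The two terms with \<open>X\<close> between the first letter and the rest of the word cancel.\<close>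
  also have "(\<Sum>c = 1..N. \<Sum>a = 1..N. ?E i c * ?X a c * ?e a j)
      = (\<Sum>c = 1..N. \<Sum>b = 1..N. ?X c b * ?E i b * ?e c j)"
    by (subst sum.swap) (simp add: mult_ac)
  also have "(\<Sum>c = 1..N. \<Sum>a = 1..N. ?X a i * ?E a c * ?e c j)
      = (\<Sum>a = 1..N. ?X a i * word_entry N (\<alpha> # w) a j)"
    by (subst sum.swap) (simp add: sum_distrib_left mult.assoc)
  also have "(\<Sum>c = 1..N. \<Sum>b = 1..N. ?E i c * ?X j b * ?e c b)
      = (\<Sum>b = 1..N. ?X j b * word_entry N (\<alpha> # w) i b)"
    by (subst sum.swap) (simp add: sum_distrib_left mult_ac)
  finally show ?case
    by simp
qed

section \<open>Membership in the invariants\<close>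

text \<open>Exponents are natural numbers and cannot cancel, so a product of monomials involves exactly
  the variables of its factors.\<close>

lemma keys_add_nat:
  "Poly_Mapping.keys (m + n) = Poly_Mapping.keys m \<union> Poly_Mapping.keys n"
  for m n :: "'a \<Rightarrow>\<^sub>0 nat"
  by (auto simp: in_keys_iff lookup_add)

lemma sym_gl_closed:
  "0 \<in> sym_gl L N" "1 \<in> sym_gl L N"
  "f \<in> sym_gl L N \<Longrightarrow> g \<in> sym_gl L N \<Longrightarrow> f + g \<in> sym_gl L N"
  "f \<in> sym_gl L N \<Longrightarrow> g \<in> sym_gl L N \<Longrightarrow> f - g \<in> sym_gl L N"
  "f \<in> sym_gl L N \<Longrightarrow> g \<in> sym_gl L N \<Longrightarrow> f * g \<in> sym_gl L N"
proof -
  show "0 \<in> sym_gl L N" "1 \<in> sym_gl L N"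
    by (simp_all add: sym_gl_def)
  show "f + g \<in> sym_gl L N" if "f \<in> sym_gl L N" "g \<in> sym_gl L N"
    using that keys_add[of f g] unfolding sym_gl_def by blast
  show "f - g \<in> sym_gl L N" if "f \<in> sym_gl L N" "g \<in> sym_gl L N"
    using that keys_diff[of f g] unfolding sym_gl_def by blast
  show "f * g \<in> sym_gl L N" if fg: "f \<in> sym_gl L N" "g \<in> sym_gl L N"
    unfolding sym_gl_def
  proof (intro CollectI ballI subsetI)
    fix m x
    assume "m \<in> Poly_Mapping.keys (f * g)" and x: "x \<in> Poly_Mapping.keys m"
    then obtain a b where ab: "a \<in> Poly_Mapping.keys f" "b \<in> Poly_Mapping.keys g" "m = a + b"
      using keys_mult[of f g] by blast
    with x have "x \<in> Poly_Mapping.keys a \<union> Poly_Mapping.keys b"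
      by (simp add: keys_add_nat)
    with ab fg show "x \<in> {1..N} \<times> {1..N} \<times> {1..L}"
      unfolding sym_gl_def by blast
  qed
qed

lemma sym_gl_sum:
  assumes "\<And>x. x \<in> A \<Longrightarrow> f x \<in> sym_gl L N"
  shows "sum f A \<in> sym_gl L N"
  using assms by (induction A rule: infinite_finite_induct) (simp_all add: sym_gl_closed)

lemma mat_unit_in_sym_gl:
  assumes "a \<in> {1..N}" "b \<in> {1..N}" "\<alpha> \<in> {1..L}"
  shows "mat_unit a b \<alpha> \<in> sym_gl L N"
  using assms by (simp add: sym_gl_def var_def)

lemma word_entry_in_sym_gl:
  assumes "set w \<subseteq> {1..L}" "i \<in> {1..N}"
  shows "word_entry N w i j \<in> sym_gl L N"
  using assms
proof (induction w arbitrary: i)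
  case Nil
  show ?case
    by (simp add: sym_gl_closed)
next
  case (Cons \<alpha> w)
  then show ?case
    by (auto intro!: sym_gl_sum sym_gl_closed(5) mat_unit_in_sym_gl)
qed

text \<open>Elements of \<open>gl_sub d N\<close> have zero rows and columns at the indices up to \<open>d\<close>, which kills both
  end terms of the action.\<close>

lemma word_entry_in_P_level:
  assumes "set w \<subseteq> {1..L}" "i \<in> {1..d}" "j \<in> {1..d}" "d \<le> N"
  shows "word_entry N w i j \<in> P_level d L N"
proof -
  have "poisson (diag_embed L N X) (word_entry N w i j) = 0" if "X \<in> gl_sub d N" for X
  proof -
    have "X a i = 0" "X j a = 0" for a
      using that assms unfolding gl_sub_def by fastforce+
    with assms show ?thesis
      by (simp add: poisson_diag_embed_word_entry)
  qed
  with assms show ?thesis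
    by (simp add: P_level_def word_entry_in_sym_gl)
qed


section \<open>Homogeneity\<close>

lemma sum_lookup_superset:
  assumes "finite A" "Poly_Mapping.keys m \<subseteq> A"
  shows "(\<Sum>x \<in> Poly_Mapping.keys m. Poly_Mapping.lookup m x) = (\<Sum>x \<in> A. Poly_Mapping.lookup m x)"
  using assms by (intro sum.mono_neutral_left) (auto simp: in_keys_iff)

lemma sum_lookup_add:
  "(\<Sum>x \<in> Poly_Mapping.keys (m + n). Poly_Mapping.lookup (m + n) x)
    = (\<Sum>x \<in> Poly_Mapping.keys m. Poly_Mapping.lookup m x)
      + (\<Sum>x \<in> Poly_Mapping.keys n. Poly_Mapping.lookup n x)"
  for m n :: "'a \<Rightarrow>\<^sub>0 nat"
proof -
  let ?A = "Poly_Mapping.keys m \<union> Poly_Mapping.keys n"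
  show ?thesis
    by (subst (1 2 3) sum_lookup_superset[of ?A])
      (auto simp: keys_add_nat lookup_add sum.distrib)
qed

lemma homogeneous_mult:
  assumes "homogeneous p f" "homogeneous q g"
  shows "homogeneous (p + q) (f * g)"
  unfolding homogeneous_def
proof
  fix m
  assume "m \<in> Poly_Mapping.keys (f * g)"
  then obtain a b where "a \<in> Poly_Mapping.keys f" "b \<in> Poly_Mapping.keys g" "m = a + b"
    using keys_mult[of f g] by blast
  with assms show "(\<Sum>x \<in> Poly_Mapping.keys m. Poly_Mapping.lookup m x) = p + q"
    by (simp add: homogeneous_def sum_lookup_add)
qed

lemma homogeneous_sum:
  assumes "\<And>x. x \<in> A \<Longrightarrow> homogeneous n (f x)"
  shows "homogeneous n (sum f A)"
  unfolding homogeneous_def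
proof
  fix m
  assume "m \<in> Poly_Mapping.keys (sum f A)"
  from subsetD[OF keys_sum this] obtain x where "x \<in> A" "m \<in> Poly_Mapping.keys (f x)"
    by blast
  with assms show "(\<Sum>x \<in> Poly_Mapping.keys m. Poly_Mapping.lookup m x) = n"
    unfolding homogeneous_def by blast
qed

lemma homogeneous_word_entry: "homogeneous (length w) (word_entry N w i j)"
proof (induction w arbitrary: i)
  case Nil
  show ?case
    by (simp add: homogeneous_def)
next
  case (Cons \<alpha> w)
  have "homogeneous 1 (var x)" for x
    by (simp add: homogeneous_def var_def)
  then have "homogeneous (1 + length w) (mat_unit i b \<alpha> * word_entry N w b j)" for b
    using Cons by (rule homogeneous_mult)
  then show ?case
    by (auto intro: homogeneous_sum)
qed


section \<open>Compatibility with the projections\<close>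

text \<open>The elements of \<open>I_plus\<close> are given by coefficients of the generators, on which the operations
  act coefficientwise.\<close>

lemma I_plus_closed:
  "0 \<in> I_plus L N"
  "f \<in> I_plus L N \<Longrightarrow> g \<in> I_plus L N \<Longrightarrow> f + g \<in> I_plus L N"
  "f \<in> I_plus L N \<Longrightarrow> g \<in> I_plus L N \<Longrightarrow> f - g \<in> I_plus L N"
  "e \<in> sym_gl L N \<Longrightarrow> f \<in> I_plus L N \<Longrightarrow> e * f \<in> I_plus L N"
proof -
  have eq: "f \<in> I_plus L N \<longleftrightarrow> (\<exists>h. (\<forall>i \<alpha>. h i \<alpha> \<in> sym_gl L N) \<and>
      f = (\<Sum>i = 1..N. \<Sum>\<alpha> = 1..L. h i \<alpha> * mat_unit i N \<alpha>))" for f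
    unfolding I_plus_def by blast
  show "0 \<in> I_plus L N"
    unfolding eq by (rule exI[of _ "\<lambda>_ _. 0"]) (simp add: sym_gl_closed)
  show "f + g \<in> I_plus L N" if fg: "f \<in> I_plus L N" "g \<in> I_plus L N"
  proof -
    obtain h where "\<forall>i \<alpha>. h i \<alpha> \<in> sym_gl L N"
      and "f = (\<Sum>i = 1..N. \<Sum>\<alpha> = 1..L. h i \<alpha> * mat_unit i N \<alpha>)"
      using fg(1) unfolding eq by blast
    moreover obtain k where "\<forall>i \<alpha>. k i \<alpha> \<in> sym_gl L N"
      and "g = (\<Sum>i = 1..N. \<Sum>\<alpha> = 1..L. k i \<alpha> * mat_unit i N \<alpha>)"
      using fg(2) unfolding eq by blast
    ultimately show ?thesis
      unfolding eq by (intro exI[of _ "\<lambda>i \<alpha>. h i \<alpha> + k i \<alpha>"])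
        (simp add: sym_gl_closed sum.distrib distrib_right)
  qed
  show "f - g \<in> I_plus L N" if fg: "f \<in> I_plus L N" "g \<in> I_plus L N"
  proof -
    obtain h where "\<forall>i \<alpha>. h i \<alpha> \<in> sym_gl L N"
      and "f = (\<Sum>i = 1..N. \<Sum>\<alpha> = 1..L. h i \<alpha> * mat_unit i N \<alpha>)"
      using fg(1) unfolding eq by blast
    moreover obtain k where "\<forall>i \<alpha>. k i \<alpha> \<in> sym_gl L N"
      and "g = (\<Sum>i = 1..N. \<Sum>\<alpha> = 1..L. k i \<alpha> * mat_unit i N \<alpha>)"
      using fg(2) unfolding eq by blast
    ultimately show ?thesis
      unfolding eq by (intro exI[of _ "\<lambda>i \<alpha>. h i \<alpha> - k i \<alpha>"])
        (simp add: sym_gl_closed sum_subtractf left_diff_distrib)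
  qed
  show "e * f \<in> I_plus L N" if ef: "e \<in> sym_gl L N" "f \<in> I_plus L N"
  proof -
    obtain h where "\<forall>i \<alpha>. h i \<alpha> \<in> sym_gl L N"
      and "f = (\<Sum>i = 1..N. \<Sum>\<alpha> = 1..L. h i \<alpha> * mat_unit i N \<alpha>)"
      using ef(2) unfolding eq by blast
    with ef(1) show ?thesis
      unfolding eq by (intro exI[of _ "\<lambda>i \<alpha>. e * h i \<alpha>"])
        (simp add: sym_gl_closed sum_distrib_left mult.assoc)
  qed
qed

lemma I_plus_sum:
  assumes "\<And>x. x \<in> A \<Longrightarrow> f x \<in> I_plus L N"
  shows "sum f A \<in> I_plus L N"
  using assms by (induction A rule: infinite_finite_induct) (simp_all add: I_plus_closed)

lemma mat_unit_mult_in_I_plus: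
  assumes "f \<in> sym_gl L N" "i \<in> {1..N}" "\<alpha> \<in> {1..L}"
  shows "mat_unit i N \<alpha> * f \<in> I_plus L N"
proof -
  let ?h = "\<lambda>i' \<alpha>'. if i' = i then if \<alpha>' = \<alpha> then f else 0 else 0"
  have "(\<Sum>i' = 1..N. \<Sum>\<alpha>' = 1..L. ?h i' \<alpha>' * mat_unit i' N \<alpha>')
      = (\<Sum>i' = 1..N. if i' = i then \<Sum>\<alpha>' = 1..L. if \<alpha>' = \<alpha> then f * mat_unit i N \<alpha> else 0 else 0)"
    by (intro sum.cong refl) (auto simp: if_distrib[of "\<lambda>x. x * _"] cong: if_cong)
  also have "\<dots> = mat_unit i N \<alpha> * f"
    using assms by (simp add: mult.commute)
  finally show ?thesis
    unfolding I_plus_def using assms(1)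
    by (intro CollectI exI[of _ ?h]) (simp add: sym_gl_closed)
qed

text \<open>Each monomial of an element of the ideal contains a variable with column index \<open>N + 1\<close>, and no
  monomial of level \<open>N\<close> does.\<close>

lemma sym_gl_inter_I_plus:
  assumes "f \<in> sym_gl L N" "f \<in> I_plus L (Suc N)"
  shows "f = 0"
proof (rule ccontr)
  assume "f \<noteq> 0"
  then obtain m where m: "m \<in> Poly_Mapping.keys f"
    by fastforce
  obtain h where "f = (\<Sum>i = 1..Suc N. \<Sum>\<alpha> = 1..L. h i \<alpha> * mat_unit i (Suc N) \<alpha>)"
    using assms(2) unfolding I_plus_def by blast
  from subsetD[OF keys_sum m[unfolded this]] obtain i where
    "m \<in> Poly_Mapping.keys (\<Sum>\<alpha> = 1..L. h i \<alpha> * mat_unit i (Suc N) \<alpha>)"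
    by blast
  from subsetD[OF keys_sum this] obtain \<alpha> where
    "m \<in> Poly_Mapping.keys (h i \<alpha> * mat_unit i (Suc N) \<alpha>)"
    by blast
  then obtain a where "m = a + Poly_Mapping.single (i, Suc N, \<alpha>) 1"
    using keys_mult[of "h i \<alpha>" "mat_unit i (Suc N) \<alpha>"] by (auto simp: var_def)
  then have "(i, Suc N, \<alpha>) \<in> Poly_Mapping.keys m"
    by (simp add: keys_add_nat)
  with m assms(1) show False
    unfolding sym_gl_def by fastforce
qed

lemma proj_eqI:
  assumes "g \<in> sym_gl L N" "f - g \<in> P_level N L (Suc N)" "f - g \<in> I_plus L (Suc N)"
  shows "proj L (Suc N) f = g"
  unfolding proj_def
proof (rule the_equality)
  fix g'
  assume "g' \<in> sym_gl L (Suc N - 1) \<and> f - g' \<in> P_level (Suc N - 1) L (Suc N) \<inter> I_plus L (Suc N)"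
  then have g': "g' \<in> sym_gl L N" "f - g' \<in> I_plus L (Suc N)"
    by simp_all
  have "g' - g \<in> sym_gl L N" "(f - g) - (f - g') \<in> I_plus L (Suc N)"
    using assms g' by (auto simp only: intro: sym_gl_closed(4) I_plus_closed(3))
  then have "g' - g = 0"
    by (intro sym_gl_inter_I_plus) simp_all
  then show "g' = g"
    by simp
qed (use assms in simp)

text \<open>Raising the level adds the summands that pass through the index \<open>N + 1\<close>. If the first letter
  ends there, it is itself a generator of the ideal; otherwise the index occurs later in the word.\<close>

lemma word_entry_Suc_diff_in_I_plus:
  assumes "set w \<subseteq> {1..L}" "i \<in> {1..Suc N}"
  shows "word_entry (Suc N) w i j - word_entry N w i j \<in> I_plus L (Suc N)"
  using assms
proof (induction w arbitrary: i)
  case Nil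
  show ?case
    by (simp add: I_plus_closed)
next
  case (Cons \<alpha> w)
  have "word_entry (Suc N) (\<alpha> # w) i j - word_entry N (\<alpha> # w) i j
      = (\<Sum>b = 1..N. mat_unit i b \<alpha> * (word_entry (Suc N) w b j - word_entry N w b j))
        + mat_unit i (Suc N) \<alpha> * word_entry (Suc N) w (Suc N) j"
    by (simp add: right_diff_distrib sum_subtractf)
  also have "\<dots> \<in> I_plus L (Suc N)"
  proof (rule I_plus_closed(2))
    show "(\<Sum>b = 1..N. mat_unit i b \<alpha> * (word_entry (Suc N) w b j - word_entry N w b j))
        \<in> I_plus L (Suc N)"
      using Cons by (intro I_plus_sum I_plus_closed(4) mat_unit_in_sym_gl) auto
    show "mat_unit i (Suc N) \<alpha> * word_entry (Suc N) w (Suc N) j \<in> I_plus L (Suc N)"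
      using Cons.prems by (intro mat_unit_mult_in_I_plus word_entry_in_sym_gl) auto
  qed
  finally show ?case .
qed

text \<open>The only entry of such an \<open>X\<close> is at \<open>(N + 1, N + 1)\<close>, and the corresponding matrix unit
  commutes with all those of level \<open>N\<close>. It makes the element of the lower level an invariant at
  level \<open>N + 1\<close>, as the characterization of the projection demands.\<close>

lemma poisson_diag_embed_corner_word_entry:
  assumes "X \<in> gl_sub N (Suc N)" "set w \<subseteq> {1..L}" "i \<in> {1..N}"
  shows "poisson (diag_embed L (Suc N) X) (word_entry N w i j) = 0"
proof -
  have "poisson (diag_embed L (Suc N) X) (mat_unit a b (w ! t)) = 0"
    if "a \<in> {1..N}" "b \<in> {1..N}" "t < length w" for a b t
  proof -
    have "X c a = 0" "X b c = 0" for c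
      using assms(1) that unfolding gl_sub_def by fastforce+
    moreover have "w ! t \<in> {1..L}"
      using assms(2) that(3) nth_mem by blast
    ultimately show ?thesis
      by (simp add: poisson_diag_embed_mat_unit)
  qed
  then show ?thesis
    unfolding poisson_right.word_entry[OF assms(3)] by simp
qed

lemma proj_word_entry:
  assumes "set w \<subseteq> {1..L}" "i \<in> {1..N}" "j \<in> {1..N}"
  shows "proj L (Suc N) (word_entry (Suc N) w i j) = word_entry N w i j"
proof (rule proj_eqI)
  show small: "word_entry N w i j \<in> sym_gl L N"
    using assms by (simp add: word_entry_in_sym_gl)
  show "word_entry (Suc N) w i j - word_entry N w i j \<in> I_plus L (Suc N)"
    using assms by (intro word_entry_Suc_diff_in_I_plus) auto
  have large: "word_entry (Suc N) w i j \<in> P_level N L (Suc N)"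
    using assms by (intro word_entry_in_P_level) auto
  have "word_entry N w i j \<in> sym_gl L (Suc N)"
    using small unfolding sym_gl_def by fastforce
  with assms have "word_entry N w i j \<in> P_level N L (Suc N)"
    by (simp add: P_level_def poisson_diag_embed_corner_word_entry)
  with large show "word_entry (Suc N) w i j - word_entry N w i j \<in> P_level N L (Suc N)"
    by (simp add: P_level_def sym_gl_closed poisson_right.diff)
qed


section \<open>The bracket in the limit\<close>

lemma p_seq_apply:
  assumes "j \<in> {1..d}"
  shows "p_seq d i j w N = (if d \<le> N then word_entry N w i j else 0)"
  using assms p_level_eq_word_entry[of w j N i] by (auto simp: p_seq_def P_one_def)

lemma p_seq_in_P_comp:
  assumes "set w \<subseteq> {1..L}" "i \<in> {1..d}" "j \<in> {1..d}"
  shows "p_seq d i j w \<in> P_comp d L (length w)"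
  unfolding P_comp_def
proof (intro CollectI conjI allI impI)
  fix N
  show "p_seq d i j w N = 0" if "N < d"
    using that assms by (simp add: p_seq_apply)
  assume N: "d \<le> N"
  show "p_seq d i j w N \<in> P_level d L N"
    using assms N by (simp add: p_seq_apply word_entry_in_P_level)
  show "homogeneous (length w) (p_seq d i j w N)"
    using assms N by (simp add: p_seq_apply homogeneous_word_entry)
  show "proj L (Suc N) (p_seq d i j w (Suc N)) = p_seq d i j w N"
    using assms N proj_word_entry[of w L i N j] by (simp add: p_seq_apply)
qed

lemma zero_in_P_comp: "0 \<in> P_comp d L n"
proof -
  have "0 \<in> P_level d L N" for d N
    by (simp add: P_level_def sym_gl_closed)
  then show ?thesis
    by (auto simp: P_comp_def homogeneous_def sym_gl_closed I_plus_closed intro!: proj_eqI)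
qed

text \<open>A homogeneous sequence is a sum of homogeneous sequences of which all others are zero; the
  zero sequence belongs to every degree.\<close>

lemma P_comp_subset_P_lim: "P_comp d L n \<subseteq> P_lim d L"
proof
  fix G
  assume G: "G \<in> P_comp d L n"
  have "G = (\<Sum>m \<le> n. if m = n then G else 0)"
    by simp
  with G show "G \<in> P_lim d L"
    unfolding P_lim_def
    by (intro CollectI exI[of _ n] exI[of _ "\<lambda>m. if m = n then G else 0"])
      (simp add: zero_in_P_comp)
qed

lemma sum_fun_apply: "(\<Sum>x \<in> A. f x) y = (\<Sum>x \<in> A. f x y)"
  for f :: "'a \<Rightarrow> 'b \<Rightarrow> 'c :: comm_monoid_add"
  by (induction A rule: infinite_finite_induct) simp_all

theorem proposition5p2:
  fixes d L i j k l :: nat and z w :: "nat list"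
  assumes "d \<ge> 1" and "L \<ge> 2"
    and "i \<in> {1..d}" and "j \<in> {1..d}" and "k \<in> {1..d}" and "l \<in> {1..d}"
    and "z \<noteq> []" and "set z \<subseteq> {1..L}"
    and "w \<noteq> []" and "set w \<subseteq> {1..L}"
  shows "P_bracket d L (p_seq d i j z) (p_seq d k l w) =
    (\<Sum>r = 1..length z. \<Sum>q = 1..length w.
       if z ! (r - 1) = w ! (q - 1)
       then p_seq d k j (take (q - 1) w @ drop r z) * p_seq d i l (take r z @ drop q w)
          - p_seq d k j (take (q - 1) w @ drop (r - 1) z) * p_seq d i l (take (r - 1) z @ drop q w)
       else 0)"
proof
  fix N
  have "p_seq d i j z \<in> P_lim d L" "p_seq d k l w \<in> P_lim d L"
    using assms p_seq_in_P_comp P_comp_subset_P_lim by blast+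
  then have bracket: "P_bracket d L (p_seq d i j z) (p_seq d k l w) N
      = poisson (p_seq d i j z N) (p_seq d k l w N)"
    by (simp add: P_bracket_def)
  show "P_bracket d L (p_seq d i j z) (p_seq d k l w) N =
    (\<Sum>r = 1..length z. \<Sum>q = 1..length w.
       if z ! (r - 1) = w ! (q - 1)
       then p_seq d k j (take (q - 1) w @ drop r z) * p_seq d i l (take r z @ drop q w)
          - p_seq d k j (take (q - 1) w @ drop (r - 1) z) * p_seq d i l (take (r - 1) z @ drop q w)
       else 0) N"
  \<comment> \<open>Below \<open>d\<close> there is no level, and both sides are zero by convention.\<close>
  proof (cases "d \<le> N")
    case True
    with assms have "i \<in> {1..N}" "k \<in> {1..N}"
      by auto
    with True assms show ?thesis
      unfolding bracket sum_fun_apply One_nat_def sum.atLeast1_atMost_eq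
      by (simp add: p_seq_apply poisson_word_entry if_distrib[of "\<lambda>f. f N"]
          cong: if_cong del: word_entry.simps)
  next
    case False
    with assms show ?thesis
      unfolding bracket sum_fun_apply
      by (simp add: p_seq_apply if_distrib[of "\<lambda>f. f N"] cong: if_cong)
  qed
qed

end
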